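(* Let $\Bbbk$ be an algebraically closed field with $\operatorname{char}(\Bbbk)\neq 2$, let $\mu_{ij}\in\Bbbk^\times$ ($1\le i,j\le 3$) satisfy $\mu_{ii}=1$ and $\mu_{ij}\mu_{ji}=1$ for all $i,j$, and let $S$ be the graded $\Bbbk$-algebra on degree-one generators $z_1,z_2,z_3$ with defining relations $z_jz_i=\mu_{ij}z_iz_j$ for all $i,j$. If $Q=az_1^2+bz_2^2+cz_3^2+2dz_1z_2+2ez_1z_3+2fz_2z_3\in S_2$, where $a,\ldots,f\in\Bbbk$, then $Q=L_1L_2+L_3^2$ for some $L_1,L_2,L_3\in S_1$.
   Context: $S_i$ denotes the span of the homogeneous elements of $S$ of degree $i$. A quadratic form is any element of $S_2$. The elements $L_1,L_2,L_3$ are not required to be nonzero or linearly independent. *)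

theory Defs
  imports
    "HOL-Library.Poly_Mapping"
    "HOL-Library.Numeral_Type"
    "HOL-Algebra.Algebraic_Closure_Type"
    "HOL-Algebra.QuotRing"
begin

(* The free monoid on 'g, written additively so that 'g free_monoid \<Rightarrow>\<^sub>0 'k, with the
   convolution product of Poly_Mapping, is the free associative 'k-algebra on 'g.  The wrapper
   type avoids a global monoid instance on lists. *)

datatype 'g free_monoid = Free_Monoid (letters: "'g list")

instantiation free_monoid :: (type) monoid_add
begin

definition "0 = Free_Monoid []"
definition "u + v = Free_Monoid (letters u @ letters v)"

instance
  by standard (simp_all add: zero_free_monoid_def plus_free_monoid_def)

end

type_synonym ('g, 'k) free_algebra = "'g free_monoid \<Rightarrow>\<^sub>0 'k"

definition free_gen :: "'g \<Rightarrow> ('g, 'k::comm_ring_1) free_algebra"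
  where "free_gen i = Poly_Mapping.single (Free_Monoid [i]) 1"

definition free_const :: "'k \<Rightarrow> ('g, 'k::comm_ring_1) free_algebra"
  where "free_const c = Poly_Mapping.single 0 c"

definition free_homogeneous :: "nat \<Rightarrow> ('g, 'k::comm_ring_1) free_algebra set"
  where "free_homogeneous n = {p. \<forall>w \<in> Poly_Mapping.keys p. length (letters w) = n}"

definition skew_relators :: "('g \<Rightarrow> 'g \<Rightarrow> 'k) \<Rightarrow> ('g, 'k::comm_ring_1) free_algebra set"
  where "skew_relators \<mu> =
    {free_gen j * free_gen i - free_const (\<mu> i j) * (free_gen i * free_gen j) | i j. True}"

(* genideal is the two-sided ideal generated by a set *)

definition skew_ideal :: "('g \<Rightarrow> 'g \<Rightarrow> 'k) \<Rightarrow> ('g, 'k::comm_ring_1) free_algebra set"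
  where "skew_ideal \<mu> = genideal ring_of_type_algebra (skew_relators \<mu>)"

definition skew_alg :: "('g \<Rightarrow> 'g \<Rightarrow> 'k) \<Rightarrow> ('g, 'k::comm_ring_1) free_algebra set ring"
  where "skew_alg \<mu> = ring_of_type_algebra Quot skew_ideal \<mu>"

definition skew_proj ::
    "('g \<Rightarrow> 'g \<Rightarrow> 'k) \<Rightarrow> ('g, 'k) free_algebra \<Rightarrow> ('g, 'k::comm_ring_1) free_algebra set"
  where "skew_proj \<mu> p = skew_ideal \<mu> +>\<^bsub>ring_of_type_algebra\<^esub> p"

definition skew_gen :: "('g \<Rightarrow> 'g \<Rightarrow> 'k) \<Rightarrow> 'g \<Rightarrow> ('g, 'k::comm_ring_1) free_algebra set"
  where "skew_gen \<mu> i = skew_proj \<mu> (free_gen i)"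

definition skew_scale ::
    "('g \<Rightarrow> 'g \<Rightarrow> 'k) \<Rightarrow> 'k \<Rightarrow> ('g, 'k) free_algebra set \<Rightarrow> ('g, 'k::comm_ring_1) free_algebra set"
  where "skew_scale \<mu> c x = skew_proj \<mu> (free_const c) \<otimes>\<^bsub>skew_alg \<mu>\<^esub> x"

(* The relators are homogeneous, so the grading by word length descends to the quotient. *)

definition skew_graded_part ::
    "('g \<Rightarrow> 'g \<Rightarrow> 'k) \<Rightarrow> nat \<Rightarrow> ('g, 'k::comm_ring_1) free_algebra set set"
  where "skew_graded_part \<mu> n = skew_proj \<mu> ` free_homogeneous n"


lemma ring_ring_of_type_algebra: "ring (ring_of_type_algebra :: 'a::ring_1 ring)"
proof -
  have "\<exists>y. x + y = 0" "\<exists>y. y + x = 0" for x :: 'a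
    using add.right_inverse add.left_inverse by blast+
  then show ?thesis
    unfolding ring_of_type_algebra_def
    by unfold_locales (auto simp: algebra_simps Units_def)
qed

lemma ring_of_type_algebra_simps [simp]:
  "carrier (ring_of_type_algebra :: 'a::ring_1 ring) = UNIV"
  "x \<otimes>\<^bsub>ring_of_type_algebra\<^esub> y = (x * y :: 'a)"
  "x \<oplus>\<^bsub>ring_of_type_algebra\<^esub> y = (x + y :: 'a)"
  "\<one>\<^bsub>ring_of_type_algebra\<^esub> = (1 :: 'a)"
  "\<zero>\<^bsub>ring_of_type_algebra\<^esub> = (0 :: 'a)"
  by (simp_all add: ring_of_type_algebra_def)

lemma ideal_skew_ideal: "ideal (skew_ideal \<mu>) ring_of_type_algebra"
  unfolding skew_ideal_def
  by (rule ring.genideal_ideal[OF ring_ring_of_type_algebra]) simp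

lemma ring_skew_alg: "ring (skew_alg \<mu>)"
  unfolding skew_alg_def by (rule ideal.quotient_is_ring[OF ideal_skew_ideal])

lemma skew_proj_ring_hom: "skew_proj \<mu> \<in> ring_hom ring_of_type_algebra (skew_alg \<mu>)"
  using ideal.rcos_ring_hom[OF ideal_skew_ideal, of \<mu>]
  by (simp add: skew_proj_def[abs_def] skew_alg_def)

lemma skew_proj_mult: "skew_proj \<mu> (p * q) = skew_proj \<mu> p \<otimes>\<^bsub>skew_alg \<mu>\<^esub> skew_proj \<mu> q"
  using ring_hom_mult[OF skew_proj_ring_hom, of p q \<mu>] by simp

lemma skew_proj_add: "skew_proj \<mu> (p + q) = skew_proj \<mu> p \<oplus>\<^bsub>skew_alg \<mu>\<^esub> skew_proj \<mu> q"
  using ring_hom_add[OF skew_proj_ring_hom, of p q \<mu>] by simp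

lemma carrier_skew_alg: "carrier (skew_alg \<mu>) = range (skew_proj \<mu>)"
  by (auto simp: skew_alg_def skew_proj_def FactRing_def A_RCOSETS_defs a_r_coset_defs)

lemma skew_proj_eq:
  assumes "p - q \<in> skew_ideal \<mu>"
  shows "skew_proj \<mu> p = skew_proj \<mu> q"
proof -
  interpret ideal "skew_ideal \<mu>" ring_of_type_algebra by (rule ideal_skew_ideal)
  have "p = (p - q) \<oplus>\<^bsub>ring_of_type_algebra\<^esub> q"
    by simp
  then have "p \<in> skew_ideal \<mu> +>\<^bsub>ring_of_type_algebra\<^esub> q"
    using assms unfolding a_r_coset_def' by blast
  from a_repr_independence[OF this _ a_subgroup] show ?thesis
    by (simp add: skew_proj_def)
qed

lemma skew_relation:
  "skew_gen \<mu> j \<otimes>\<^bsub>skew_alg \<mu>\<^esub> skew_gen \<mu> i =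
   skew_scale \<mu> (\<mu> i j) (skew_gen \<mu> i \<otimes>\<^bsub>skew_alg \<mu>\<^esub> skew_gen \<mu> j)"
proof -
  have "skew_relators \<mu> \<subseteq> skew_ideal \<mu>"
    unfolding skew_ideal_def
    by (rule ring.genideal_self[OF ring_ring_of_type_algebra]) simp
  then have "free_gen j * free_gen i - free_const (\<mu> i j) * (free_gen i * free_gen j)
      \<in> skew_ideal \<mu>"
    by (auto simp: skew_relators_def)
  from skew_proj_eq[OF this] show ?thesis
    by (simp add: skew_gen_def skew_scale_def skew_proj_mult)
qed

lemma skew_graded_part_add:
  assumes "x \<in> skew_graded_part \<mu> n" "y \<in> skew_graded_part \<mu> n"
  shows "x \<oplus>\<^bsub>skew_alg \<mu>\<^esub> y \<in> skew_graded_part \<mu> n"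
proof -
  obtain p q where "p \<in> free_homogeneous n" "q \<in> free_homogeneous n"
    and xy: "x = skew_proj \<mu> p" "y = skew_proj \<mu> q"
    using assms by (auto simp: skew_graded_part_def)
  then have "p + q \<in> free_homogeneous n"
    using Poly_Mapping.keys_add[of p q] by (auto simp: free_homogeneous_def)
  then show ?thesis
    by (auto simp: skew_graded_part_def xy skew_proj_add[symmetric])
qed

lemma skew_graded_part_mult:
  assumes "x \<in> skew_graded_part \<mu> m" "y \<in> skew_graded_part \<mu> n"
  shows "x \<otimes>\<^bsub>skew_alg \<mu>\<^esub> y \<in> skew_graded_part \<mu> (m + n)"
proof -
  obtain p q where "p \<in> free_homogeneous m" "q \<in> free_homogeneous n"
    and xy: "x = skew_proj \<mu> p" "y = skew_proj \<mu> q"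
    using assms by (auto simp: skew_graded_part_def)
  then have "p * q \<in> free_homogeneous (m + n)"
    using Poly_Mapping.keys_mult[of p q]
    by (fastforce simp: free_homogeneous_def plus_free_monoid_def)
  then show ?thesis
    by (auto simp: skew_graded_part_def xy skew_proj_mult[symmetric])
qed

lemma skew_gen_graded: "skew_gen \<mu> i \<in> skew_graded_part \<mu> 1"
  by (auto simp: skew_gen_def skew_graded_part_def free_homogeneous_def free_gen_def)

lemma skew_const_graded: "skew_proj \<mu> (free_const c) \<in> skew_graded_part \<mu> 0"
  by (auto simp: skew_graded_part_def free_homogeneous_def free_const_def
      zero_free_monoid_def split: if_splits)

lemma skew_scale_graded:
  "x \<in> skew_graded_part \<mu> n \<Longrightarrow> skew_scale \<mu> c x \<in> skew_graded_part \<mu> n"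
  unfolding skew_scale_def using skew_graded_part_mult[OF skew_const_graded] by fastforce

lemma skew_monomial_graded:
  "skew_scale \<mu> c (skew_gen \<mu> i \<otimes>\<^bsub>skew_alg \<mu>\<^esub> skew_gen \<mu> j) \<in> skew_graded_part \<mu> 2"
  using skew_scale_graded[OF skew_graded_part_mult[OF skew_gen_graded skew_gen_graded]]
  by (simp add: numeral_2_eq_2)

end

theory Submission
  imports Defs
begin

text \<open>
  Comparing coefficients, one has to solve six quadratic equations for the coefficients \<open>x\<close>, \<open>y\<close>,
  \<open>w\<close> of \<open>L1\<close>, \<open>L2\<close>, \<open>L3\<close>. If \<open>d = e = 0\<close>, then \<open>L3\<close> can absorb \<open>a z1\<^sup>2\<close>, and the remaining
  form in \<open>z2\<close>, \<open>z3\<close> factors. Otherwise take \<open>w1\<^sup>2 = a\<close>, \<open>x1 = 0\<close>, \<open>y1 = 1\<close>. The coefficients of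
  \<open>z1 z2\<close> and \<open>z1 z3\<close> then determine \<open>x2\<close> as an affine function of \<open>w2\<close> and \<open>x3\<close> as one of \<open>w3\<close>.
  If both are nonzero, the squares determine \<open>y2\<close> and \<open>y3\<close>, leaving a single equation that is at
  most quadratic in each of \<open>w2\<close> and \<open>w3\<close>, with nonzero leading coefficient in one of them for a
  suitable choice of the other; if \<open>x2\<close> can vanish together with \<open>b - w2\<^sup>2\<close>, or \<open>x3\<close> together
  with \<open>c - w3\<^sup>2\<close>, the system is linear in \<open>y2\<close>, \<open>y3\<close>.
\<close>

section \<open>Roots and nonvanishing over an algebraically closed field\<close>

lemma alg_closed_quadratic_root:
  fixes A B C :: "'k::alg_closed_field"
  assumes "A \<noteq> 0"
  shows "\<exists>x. A * x\<^sup>2 + B * x + C = 0"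
proof -
  have "\<exists>x. poly [:C, B, A:] x = 0"
    using assms by (intro alg_closed_imp_poly_has_root) simp
  then show ?thesis
    by (simp add: algebra_simps power2_eq_square)
qed

lemma alg_closed_sqrt: "\<exists>x. x\<^sup>2 = (A :: 'k::alg_closed_field)"
  using alg_closed_quadratic_root[of 1 0 "- A"] by simp

text \<open>A nonconstant \<open>p\<close> attains the value 1, because \<open>p - 1\<close> has a
  root.\<close>

lemma alg_closed_poly_neq_0:
  fixes p :: "'k::alg_closed_field poly"
  assumes "p \<noteq> 0"
  shows "\<exists>x. poly p x \<noteq> 0"
proof (cases "degree p = 0")
  case True
  then obtain a where "p = [:a:]" by (rule degree_eq_zeroE)
  with assms show ?thesis by simp
next
  case False
  then have "degree (p + [:- 1:]) > 0" by (simp add: degree_add_eq_left)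
  then obtain x where "poly (p + [:- 1:]) x = 0"
    using alg_closed_imp_poly_has_root by blast
  then have "poly p x = 1" by simp
  then show ?thesis by (metis zero_neq_one)
qed

section \<open>Solving the coefficient equations\<close>

lemma affine_not_identically_0:
  fixes D s :: "'k::field"
  assumes "D \<noteq> 0 \<or> s \<noteq> 0"
  shows "\<exists>w. D - s * w \<noteq> 0"
proof (cases "D = 0")
  case True
  then show ?thesis using assms by - (rule exI[of _ 1], simp)
next
  case False
  then show ?thesis by - (rule exI[of _ 0], simp)
qed

text \<open>If \<open>u\<close> and \<open>v\<close> are nonzero, the first two equations force
  \<open>y2 = \<beta> / u\<close> and \<open>y3 = \<gamma> / v\<close>, and the third, multiplied by
  \<open>u * v\<close>, becomes the displayed condition. If one of them vanishes together with its
  right-hand side, its equation is void and the freed unknown solves the third.\<close>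

lemma compatible_quotients:
  fixes u v r \<beta> \<gamma> \<delta> :: "'k::field"
  assumes "r \<noteq> 0"
    and "u = 0 \<and> \<beta> = 0 \<and> v \<noteq> 0 \<or> v = 0 \<and> \<gamma> = 0 \<and> u \<noteq> 0 \<or>
         u \<noteq> 0 \<and> v \<noteq> 0 \<and> u\<^sup>2 * \<gamma> + r * v\<^sup>2 * \<beta> = u * v * \<delta>"
  shows "\<exists>y2 y3. u * y2 = \<beta> \<and> v * y3 = \<gamma> \<and> u * y3 + r * (v * y2) = \<delta>"
  using assms(2)
proof (elim disjE)
  assume "u = 0 \<and> \<beta> = 0 \<and> v \<noteq> 0"
  then show ?thesis
    using assms(1) by - (rule exI[of _ "\<delta> / (r * v)"], rule exI[of _ "\<gamma> / v"], simp)
next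
  assume "v = 0 \<and> \<gamma> = 0 \<and> u \<noteq> 0"
  then show ?thesis
    by - (rule exI[of _ "\<beta> / u"], rule exI[of _ "\<delta> / u"], simp)
next
  assume *: "u \<noteq> 0 \<and> v \<noteq> 0 \<and> u\<^sup>2 * \<gamma> + r * v\<^sup>2 * \<beta> = u * v * \<delta>"
  then have "u * (\<gamma> / v) + r * (v * (\<beta> / u)) = \<delta>"
    by (simp add: field_simps power2_eq_square)
  with * show ?thesis
    by - (rule exI[of _ "\<beta> / u"], rule exI[of _ "\<gamma> / v"], simp)
qed

lemma affine_system_solvable:
  fixes D E s t r k b c F :: "'k::alg_closed_field"
  assumes r: "r \<noteq> 0" and DE: "D \<noteq> 0 \<or> E \<noteq> 0"
  shows "\<exists>w2 w3 y2 y3. (D - s * w2) * y2 = b - w2\<^sup>2 \<and> (E - t * w3) * y3 = c - w3\<^sup>2 \<and>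
           (D - s * w2) * y3 + r * ((E - t * w3) * y2) = F - k * (w2 * w3)"
proof -
  have "\<exists>w2 w3. D - s * w2 = 0 \<and> b - w2\<^sup>2 = 0 \<and> E - t * w3 \<noteq> 0 \<or>
          E - t * w3 = 0 \<and> c - w3\<^sup>2 = 0 \<and> D - s * w2 \<noteq> 0 \<or>
          D - s * w2 \<noteq> 0 \<and> E - t * w3 \<noteq> 0 \<and>
          (D - s * w2)\<^sup>2 * (c - w3\<^sup>2) + r * (E - t * w3)\<^sup>2 * (b - w2\<^sup>2) =
            (D - s * w2) * (E - t * w3) * (F - k * (w2 * w3))"
    (is "\<exists>w2 w3. ?P w2 w3")
  proof -
    \<comment> \<open>Each affine factor is zero, a nonzero constant, or has exactly one root. In
      \<open>generic\<close> both have a root, and neither root makes the matching square difference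
      vanish.\<close>
    consider (D0) "D = 0" "s = 0" | (E0) "E = 0" "t = 0"
      | (D_root) w2 where "D - s * w2 = 0" "w2\<^sup>2 = b" "E \<noteq> 0 \<or> t \<noteq> 0"
      | (E_root) w3 where "E - t * w3 = 0" "w3\<^sup>2 = c" "D \<noteq> 0 \<or> s \<noteq> 0"
      | (D_const) "s = 0" "D \<noteq> 0" "E \<noteq> 0 \<or> t \<noteq> 0"
      | (E_const) "t = 0" "E \<noteq> 0" "D \<noteq> 0 \<or> s \<noteq> 0"
      | (generic) "s \<noteq> 0" "t \<noteq> 0" "(D / s)\<^sup>2 \<noteq> b" "(E / t)\<^sup>2 \<noteq> c"
      by (metis diff_self nonzero_mult_div_cancel_left times_divide_eq_right)
    then show ?thesis
    proof cases
      case D0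
      obtain w2 where "w2\<^sup>2 = b" using alg_closed_sqrt by blast
      moreover obtain w3 where "E - t * w3 \<noteq> 0"
        using affine_not_identically_0 D0 DE by blast
      ultimately have "?P w2 w3" using D0 by simp
      then show ?thesis by blast
    next
      case E0
      obtain w3 where "w3\<^sup>2 = c" using alg_closed_sqrt by blast
      moreover obtain w2 where "D - s * w2 \<noteq> 0"
        using affine_not_identically_0 E0 DE by blast
      ultimately have "?P w2 w3" using E0 by simp
      then show ?thesis by blast
    next
      case D_root
      then obtain w3 where "E - t * w3 \<noteq> 0" using affine_not_identically_0 by blast
      with D_root have "?P w2 w3" by simp
      then show ?thesis by blast
    next
      case E_root
      then obtain w2 where "D - s * w2 \<noteq> 0" using affine_not_identically_0 by blast
      with E_root have "?P w2 w3" by simp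
      then show ?thesis by blast
    next
      case D_const
      then obtain w3 where v: "E - t * w3 \<noteq> 0" using affine_not_identically_0 by blast
      define v where "v = E - t * w3"
      \<comment> \<open>The first factor is the constant \<open>D\<close>, so for fixed
        \<open>w3\<close> the condition is quadratic in \<open>w2\<close> with this leading
        coefficient.\<close>
      have "- (r * v\<^sup>2) \<noteq> 0" using r v by (simp add: v_def)
      from alg_closed_quadratic_root[OF this, of "D * v * k * w3" "D\<^sup>2 * (c - w3\<^sup>2) + r * v\<^sup>2 * b - D * v * F"]
      obtain w2 where "- (r * v\<^sup>2) * w2\<^sup>2 + D * v * k * w3 * w2
          + (D\<^sup>2 * (c - w3\<^sup>2) + r * v\<^sup>2 * b - D * v * F) = 0" by blast
      then have "D\<^sup>2 * (c - w3\<^sup>2) + r * v\<^sup>2 * (b - w2\<^sup>2) = D * v * (F - k * (w2 * w3))"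
        by (simp add: algebra_simps)
      then have "?P w2 w3" using D_const v by (simp add: v_def)
      then show ?thesis by blast
    next
      case E_const
      then obtain w2 where u: "D - s * w2 \<noteq> 0" using affine_not_identically_0 by blast
      define u where "u = D - s * w2"
      have "- (u\<^sup>2) \<noteq> 0" using u by (simp add: u_def)
      from alg_closed_quadratic_root[OF this, of "u * E * k * w2" "u\<^sup>2 * c + r * E\<^sup>2 * (b - w2\<^sup>2) - u * E * F"]
      obtain w3 where "- (u\<^sup>2) * w3\<^sup>2 + u * E * k * w2 * w3
          + (u\<^sup>2 * c + r * E\<^sup>2 * (b - w2\<^sup>2) - u * E * F) = 0" by blast
      then have "u\<^sup>2 * (c - w3\<^sup>2) + r * E\<^sup>2 * (b - w2\<^sup>2) = u * E * (F - k * (w2 * w3))"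
        by (simp add: algebra_simps)
      then have "?P w2 w3" using E_const u by (simp add: u_def)
      then show ?thesis by blast
    next
      case generic
      \<comment> \<open>\<open>?A\<close> is the coefficient of \<open>w2\<^sup>2\<close> in the equation to be solved, as a polynomial in \<open>w3\<close>.
        It is nonzero at the root \<open>E / t\<close> of \<open>?V\<close>, so some \<open>w3\<close> avoids the zeros of both.\<close>
      let ?V = "[:E, - t:]"
      let ?A = "[:s\<^sup>2 * c, 0, - (s\<^sup>2):] - smult r (?V\<^sup>2) - smult (s * k) (?V * [:0, 1:])"
      have A: "poly ?A w = s\<^sup>2 * (c - w\<^sup>2) - r * (E - t * w)\<^sup>2 - s * k * (E - t * w) * w" for w
        by (simp add: algebra_simps power2_eq_square)
      have "poly ?A (E / t) = s\<^sup>2 * (c - (E / t)\<^sup>2)"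
        using generic(2) unfolding A by simp
      moreover have "c - (E / t)\<^sup>2 \<noteq> 0"
        using generic(4) by (metis right_minus_eq)
      ultimately have "poly ?A (E / t) \<noteq> 0"
        using generic(1) by (metis mult_eq_0_iff power_eq_0_iff)
      then have "?A \<noteq> 0" by (metis poly_0)
      moreover have "?V \<noteq> 0" using generic by simp
      ultimately have "?A * ?V \<noteq> 0" by (metis mult_eq_0_iff)
      then obtain w3 where "poly (?A * ?V) w3 \<noteq> 0"
        using alg_closed_poly_neq_0 by blast
      then have lead: "poly ?A w3 \<noteq> 0" and v: "E - t * w3 \<noteq> 0"
        unfolding poly_mult by (auto simp: mult.commute)
      define v where "v = E - t * w3"
      \<comment> \<open>The condition expanded in powers of \<open>w2\<close>, for the chosen
        \<open>w3\<close>.\<close>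
      from alg_closed_quadratic_root[OF lead,
          of "D * v * k * w3 + s * v * F - 2 * D * s * (c - w3\<^sup>2)"
             "D\<^sup>2 * (c - w3\<^sup>2) + r * v\<^sup>2 * b - D * v * F"]
      obtain w2 where "(s\<^sup>2 * (c - w3\<^sup>2) - r * v\<^sup>2 - s * k * v * w3) * w2\<^sup>2
          + (D * v * k * w3 + s * v * F - 2 * D * s * (c - w3\<^sup>2)) * w2
          + (D\<^sup>2 * (c - w3\<^sup>2) + r * v\<^sup>2 * b - D * v * F) = 0"
        by (auto simp only: A v_def)
      then have eq: "(D - s * w2)\<^sup>2 * (c - w3\<^sup>2) + r * v\<^sup>2 * (b - w2\<^sup>2)
          = (D - s * w2) * v * (F - k * (w2 * w3))"
        by (simp add: algebra_simps power2_eq_square)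
      \<comment> \<open>At \<open>w2 = D / s\<close> the equation would collapse to
        \<open>r * v\<^sup>2 * (b - w2\<^sup>2) = 0\<close>, against
        \<open>(D / s)\<^sup>2 \<noteq> b\<close>.\<close>
      have "D - s * w2 \<noteq> 0"
      proof
        assume u: "D - s * w2 = 0"
        then have "w2 = D / s" using generic by (simp add: field_simps)
        with eq u v r generic show False by (simp add: v_def)
      qed
      with eq v have "?P w2 w3" by (simp add: v_def)
      then show ?thesis by blast
    qed
  qed
  then obtain w2 w3 where "?P w2 w3" by blast
  from compatible_quotients[OF r this] show ?thesis by blast
qed

text \<open>Normalising \<open>x2 = 1\<close> forces \<open>y2 = b\<close> and
  \<open>y3 = F - r * x3 * b\<close>, which leaves one polynomial equation for \<open>x3\<close>:
  quadratic if \<open>b \<noteq> 0\<close>, linear if only \<open>F \<noteq> 0\<close>. Otherwise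
  only the \<open>c\<close> term remains.\<close>

lemma skew_binary_form_factors:
  fixes b c F r :: "'k::alg_closed_field"
  assumes r: "r \<noteq> 0"
  shows "\<exists>x2 x3 y2 y3. x2 * y2 = b \<and> x3 * y3 = c \<and> x2 * y3 + r * (x3 * y2) = F"
proof -
  consider "b \<noteq> 0" | "b = 0" "F \<noteq> 0" | "b = 0" "F = 0" by blast
  then show ?thesis
  proof cases
    case 1
    then have "r * b \<noteq> 0" using r by simp
    from alg_closed_quadratic_root[OF this, of "- F" c]
    obtain x where "r * b * x\<^sup>2 + (- F) * x + c = 0" by blast
    then show ?thesis
      by - (rule exI[of _ 1], rule exI[of _ x], rule exI[of _ b], rule exI[of _ "F - r * (x * b)"],
          simp add: algebra_simps power2_eq_square)
  next
    case 2
    then show ?thesis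
      by - (rule exI[of _ 1], rule exI[of _ "c / F"], rule exI[of _ b], rule exI[of _ F], simp)
  next
    case 3
    then show ?thesis
      by - (rule exI[of _ 0], rule exI[of _ c], rule exI[of _ 0], rule exI[of _ 1], simp)
  qed
qed

text \<open>These are the coefficients of \<open>L1 * L2 + L3\<^sup>2\<close> after reordering, with
  \<open>p\<close>, \<open>q\<close>, \<open>r\<close> standing for \<open>\<mu> 1 2\<close>,
  \<open>\<mu> 1 3\<close>, \<open>\<mu> 2 3\<close>. The factor \<open>1 + p\<close> collects both
  orders of a mixed product in the square.\<close>

lemma skew_ternary_coefficients:
  fixes a b c D E F p q r :: "'k::alg_closed_field"
  assumes "p \<noteq> 0" "q \<noteq> 0" "r \<noteq> 0"
  shows "\<exists>x1 x2 x3 y1 y2 y3 w1 w2 w3.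
    x1 * y1 + w1\<^sup>2 = a \<and> x2 * y2 + w2\<^sup>2 = b \<and> x3 * y3 + w3\<^sup>2 = c \<and>
    x1 * y2 + p * (x2 * y1) + (1 + p) * (w1 * w2) = D \<and>
    x1 * y3 + q * (x3 * y1) + (1 + q) * (w1 * w3) = E \<and>
    x2 * y3 + r * (x3 * y2) + (1 + r) * (w2 * w3) = F"
proof -
  obtain w1 where w1: "w1\<^sup>2 = a" using alg_closed_sqrt by blast
  show ?thesis
  proof (cases "D = 0 \<and> E = 0")
    case True
    obtain x2 x3 y2 y3 where "x2 * y2 = b \<and> x3 * y3 = c \<and> x2 * y3 + r * (x3 * y2) = F"
      using skew_binary_form_factors[OF assms(3)] by blast
    with w1 True show ?thesis
      by - (rule exI[of _ 0], rule exI[of _ x2], rule exI[of _ x3], rule exI[of _ 0],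
          rule exI[of _ y2], rule exI[of _ y3], rule exI[of _ w1], rule exI[of _ 0], rule exI[of _ 0], simp)
  next
    case False
    \<comment> \<open>With \<open>x1 = 0\<close> and \<open>y1 = 1\<close>, division by
      \<open>p\<close> and \<open>q\<close> solves the two mixed equations involving
      \<open>z1\<close> for \<open>x2\<close> and \<open>x3\<close>.\<close>
    then have "D / p \<noteq> 0 \<or> E / q \<noteq> 0" using assms by simp
    from affine_system_solvable[OF assms(3) this, of "(1 + p) * w1 / p" b "(1 + q) * w1 / q" c F "1 + r"]
    obtain w2 w3 y2 y3 where
      sol: "(D / p - (1 + p) * w1 / p * w2) * y2 = b - w2\<^sup>2"
        "(E / q - (1 + q) * w1 / q * w3) * y3 = c - w3\<^sup>2"
        "(D / p - (1 + p) * w1 / p * w2) * y3 + r * ((E / q - (1 + q) * w1 / q * w3) * y2)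
           = F - (1 + r) * (w2 * w3)"
      by (elim exE conjE)
    define u where "u = D / p - (1 + p) * w1 / p * w2"
    define v where "v = E / q - (1 + q) * w1 / q * w3"
    have pu: "p * u = D - (1 + p) * (w1 * w2)" and qv: "q * v = E - (1 + q) * (w1 * w3)"
      using assms unfolding u_def v_def right_diff_distrib by (simp_all add: mult.assoc)
    have uv: "u * y2 + w2\<^sup>2 = b" "v * y3 + w3\<^sup>2 = c"
      "u * y3 + r * (v * y2) + (1 + r) * (w2 * w3) = F"
      using sol unfolding u_def[symmetric] v_def[symmetric] by simp_all
    show ?thesis
      by (rule exI[of _ 0], rule exI[of _ u], rule exI[of _ v], rule exI[of _ 1],
          rule exI[of _ y2], rule exI[of _ y3], rule exI[of _ w1], rule exI[of _ w2],
          rule exI[of _ w3]) (simp add: uv w1 pu qv)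
  qed
qed

section \<open>Normal ordering in the skew polynomial algebra\<close>

lemma skew_proj_swap:
  "skew_proj \<mu> (Poly_Mapping.single (Free_Monoid [j, i]) c) =
   skew_proj \<mu> (Poly_Mapping.single (Free_Monoid [i, j]) (\<mu> i j * c))"
proof -
  interpret ideal "skew_ideal \<mu>" ring_of_type_algebra by (rule ideal_skew_ideal)
  have "skew_relators \<mu> \<subseteq> skew_ideal \<mu>"
    unfolding skew_ideal_def
    by (rule ring.genideal_self[OF ring_ring_of_type_algebra]) simp
  then have "free_gen j * free_gen i - free_const (\<mu> i j) * (free_gen i * free_gen j)
      \<in> skew_ideal \<mu>"
    by (auto simp: skew_relators_def)
  from I_l_closed[OF this, of "free_const c"]
  show ?thesis
    by (intro skew_proj_eq)
      (simp add: free_gen_def free_const_def mult_single right_diff_distrib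
        plus_free_monoid_def zero_free_monoid_def mult.commute)
qed

text \<open>In the index type \<open>3\<close> the numeral 3 equals 0, so 1, 2, 3 are its three
  elements.\<close>

definition linear_form :: "'k \<Rightarrow> 'k \<Rightarrow> 'k \<Rightarrow> (3, 'k::comm_ring_1) free_algebra"
  where "linear_form x1 x2 x3 = Poly_Mapping.single (Free_Monoid [1]) x1
    + Poly_Mapping.single (Free_Monoid [2]) x2 + Poly_Mapping.single (Free_Monoid [3]) x3"

definition quadratic_form ::
    "'k \<Rightarrow> 'k \<Rightarrow> 'k \<Rightarrow> 'k \<Rightarrow> 'k \<Rightarrow> 'k \<Rightarrow> (3, 'k::comm_ring_1) free_algebra"
  where "quadratic_form a b c d e f = Poly_Mapping.single (Free_Monoid [1, 1]) a
    + Poly_Mapping.single (Free_Monoid [2, 2]) b + Poly_Mapping.single (Free_Monoid [3, 3]) c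
    + Poly_Mapping.single (Free_Monoid [1, 2]) d + Poly_Mapping.single (Free_Monoid [1, 3]) e
    + Poly_Mapping.single (Free_Monoid [2, 3]) f"

lemma linear_form_graded: "skew_proj \<mu> (linear_form x1 x2 x3) \<in> skew_graded_part \<mu> 1"
proof -
  have "skew_proj \<mu> (Poly_Mapping.single (Free_Monoid [i]) x) \<in> skew_graded_part \<mu> 1" for i x
    by (auto simp: skew_graded_part_def free_homogeneous_def)
  then show ?thesis
    by (simp add: linear_form_def skew_proj_add skew_graded_part_add)
qed

lemma quadratic_form_add:
  "quadratic_form a b c d e f + quadratic_form a' b' c' d' e' f' =
   quadratic_form (a + a') (b + b') (c + c') (d + d') (e + e') (f + f')"
  by (simp add: quadratic_form_def single_add ac_simps)

lemma skew_proj_linear_form_mult: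
  "skew_proj \<mu> (linear_form x1 x2 x3 * linear_form y1 y2 y3) =
   skew_proj \<mu> (quadratic_form (x1 * y1) (x2 * y2) (x3 * y3)
     (x1 * y2 + \<mu> 1 2 * (x2 * y1)) (x1 * y3 + \<mu> 1 3 * (x3 * y1)) (x2 * y3 + \<mu> 2 3 * (x3 * y2)))"
proof -
  interpret ring "skew_alg \<mu>" by (rule ring_skew_alg)
  have [simp]: "skew_proj \<mu> u \<in> carrier (skew_alg \<mu>)" for u
    by (simp add: carrier_skew_alg)
  show ?thesis
    \<comment> \<open>The swap is instantiated only at descending pairs, since unrestricted it would
      loop.\<close>
    by (simp add: linear_form_def quadratic_form_def mult_single plus_free_monoid_def
        distrib_left distrib_right skew_proj_add single_add
        skew_proj_swap[of \<mu> 2 1] skew_proj_swap[of \<mu> 3 1] skew_proj_swap[of \<mu> 3 2] a_ac)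
qed

theorem proposition3p1:
  fixes \<mu> :: "3 \<Rightarrow> 3 \<Rightarrow> 'k::alg_closed_field"
    and a b c d e f :: 'k
    and S (structure)
  assumes "CHAR('k) \<noteq> 2"
    and "\<And>i j. \<mu> i j \<noteq> 0"
    and "\<And>i. \<mu> i i = 1"
    and "\<And>i j. \<mu> i j * \<mu> j i = 1"
    and "S = skew_alg \<mu>"
    and "z = skew_gen \<mu>"
    and "Q = skew_scale \<mu> a (z 1 [^] (2::nat)) \<oplus> skew_scale \<mu> b (z 2 [^] (2::nat))
           \<oplus> skew_scale \<mu> c (z 3 [^] (2::nat)) \<oplus> skew_scale \<mu> (2 * d) (z 1 \<otimes> z 2)
           \<oplus> skew_scale \<mu> (2 * e) (z 1 \<otimes> z 3) \<oplus> skew_scale \<mu> (2 * f) (z 2 \<otimes> z 3)"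
  shows "\<exists>L1 \<in> skew_graded_part \<mu> 1. \<exists>L2 \<in> skew_graded_part \<mu> 1. \<exists>L3 \<in> skew_graded_part \<mu> 1.
           Q = L1 \<otimes> L2 \<oplus> L3 [^] (2::nat)"
proof -
  interpret ring S unfolding assms(5) by (rule ring_skew_alg)
  have square: "skew_proj \<mu> u [^] (2::nat) = skew_proj \<mu> (u * u)" for u
    by (simp add: numeral_2_eq_2 assms(5) skew_proj_mult carrier_skew_alg
        monoid.l_one[OF ring.is_monoid[OF ring_skew_alg]])
  have scale: "skew_scale \<mu> x (skew_proj \<mu> (free_gen i * free_gen j)) =
      skew_proj \<mu> (Poly_Mapping.single (Free_Monoid [i, j]) x)" for x i j
    unfolding skew_scale_def skew_proj_mult[symmetric]
    by (simp add: free_gen_def free_const_def mult_single plus_free_monoid_def zero_free_monoid_def)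
  have mult: "z i \<otimes> z j = skew_proj \<mu> (free_gen i * free_gen j)" for i j
    by (simp add: assms(5,6) skew_gen_def skew_proj_mult)
  have Q: "Q = skew_proj \<mu> (quadratic_form a b c (2 * d) (2 * e) (2 * f))"
    unfolding assms(7) mult
    by (simp add: assms(6) skew_gen_def square scale quadratic_form_def skew_proj_add)
      (simp add: assms(5))
  obtain x1 x2 x3 y1 y2 y3 w1 w2 w3 where
    "x1 * y1 + w1\<^sup>2 = a" "x2 * y2 + w2\<^sup>2 = b" "x3 * y3 + w3\<^sup>2 = c"
    "x1 * y2 + \<mu> 1 2 * (x2 * y1) + (1 + \<mu> 1 2) * (w1 * w2) = 2 * d"
    "x1 * y3 + \<mu> 1 3 * (x3 * y1) + (1 + \<mu> 1 3) * (w1 * w3) = 2 * e"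
    "x2 * y3 + \<mu> 2 3 * (x3 * y2) + (1 + \<mu> 2 3) * (w2 * w3) = 2 * f"
    using skew_ternary_coefficients[OF assms(2) assms(2) assms(2)] by metis
  then have "Q = skew_proj \<mu> (linear_form x1 x2 x3 * linear_form y1 y2 y3
      + linear_form w1 w2 w3 * linear_form w1 w2 w3)"
    unfolding Q skew_proj_add skew_proj_linear_form_mult
    \<comment> \<open>Both summands merge into one \<open>quadratic_form\<close>, to be compared
      with \<open>Q\<close> coefficientwise.\<close>
    unfolding skew_proj_add[symmetric] quadratic_form_add
    by (simp add: algebra_simps power2_eq_square)
  also have "\<dots> = skew_proj \<mu> (linear_form x1 x2 x3) \<otimes> skew_proj \<mu> (linear_form y1 y2 y3)
      \<oplus> skew_proj \<mu> (linear_form w1 w2 w3) [^] (2::nat)"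
    unfolding square by (simp add: assms(5) skew_proj_add skew_proj_mult)
  finally show ?thesis
    using linear_form_graded by blast
qed

end
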